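(* Let $\mathcal{R}$ be an associative ring with unit $1\neq 0$ and let $a,x\in\mathcal{R}$. Then the following assertions are equivalent: (1) $x\in a\{1\}$. (2) $\varphi_{ax}=\rho_{a\mathcal{R},\,{\rm rann}(ax)}$. (3) $\varphi_{xa}=\rho_{xa\mathcal{R},\,{\rm rann}(a)}$. (4) ${}_{ax}\varphi=\rho_{\mathcal{R}ax,\,{\rm lann}(a)}$. (5) ${}_{xa}\varphi=\rho_{\mathcal{R}a,\,{\rm lann}(xa)}$.
   Context: For $a\in\mathcal{R}$: $a\{1\}=\{x\in\mathcal{R}: axa=a\}$; $a\mathcal{R}=\{ar:r\in\mathcal{R}\}$, $\mathcal{R}a=\{ra:r\in\mathcal{R}\}$, ${\rm rann}(a)=\{r\in\mathcal{R}:ar=0\}$, ${\rm lann}(a)=\{r\in\mathcal{R}:ra=0\}$. The additive group endomorphisms $\varphi_a,{}_a\varphi:\mathcal{R}\to\mathcal{R}$ are $\varphi_a(r)=ar$ and ${}_a\varphi(r)=ra$. For additive subgroups $\mathcal{S},\mathcal{T}$ of $\mathcal{R}$, $\mathcal{R}=\mathcal{S}\oplus\mathcal{T}$ means $\mathcal{R}=\mathcal{S}+\mathcal{T}$ and $\mathcal{S}\cap\mathcal{T}=\{0\}$; in that case $\rho_{\mathcal{S},\mathcal{T}}:\mathcal{R}\to\mathcal{R}$ is the group endomorphism $\rho_{\mathcal{S},\mathcal{T}}(s+t)=s$ for $s\in\mathcal{S}$, $t\in\mathcal{T}$. Convention: whenever $\rho_{\mathcal{S},\mathcal{T}}$ is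 written, it is implicitly asserted that $\mathcal{R}=\mathcal{S}\oplus\mathcal{T}$ (so a condition such as $\varphi_{ax}=\rho_{\mathcal{S},\mathcal{T}}$ means: $\mathcal{R}=\mathcal{S}\oplus\mathcal{T}$ and the two maps are equal). *)

theory Defs
  imports Main "HOL-Library.Set_Algebras"
begin

text \<open>The class \<^class>\<open>ring_1\<close> is that of associative rings with unit and \<open>1 \<noteq> 0\<close>.\<close>

definition inner_inverses :: "'a::ring_1 \<Rightarrow> 'a set" where
  "inner_inverses a = {x. a * x * a = a}"

definition right_ideal :: "'a::ring_1 \<Rightarrow> 'a set" where
  "right_ideal a = {a * r | r. True}"

definition left_ideal :: "'a::ring_1 \<Rightarrow> 'a set" where
  "left_ideal a = {r * a | r. True}"

definition rann :: "'a::ring_1 \<Rightarrow> 'a set" where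
  "rann a = {r. a * r = 0}"

definition lann :: "'a::ring_1 \<Rightarrow> 'a set" where
  "lann a = {r. r * a = 0}"

definition lmult :: "'a::ring_1 \<Rightarrow> 'a \<Rightarrow> 'a" where
  "lmult a = (\<lambda>r. a * r)"

definition rmult :: "'a::ring_1 \<Rightarrow> 'a \<Rightarrow> 'a" where
  "rmult a = (\<lambda>r. r * a)"

text \<open>Both definitions below are meant for additive subgroups \<open>S\<close> and \<open>T\<close>; principal
  one-sided ideals and annihilators are additive subgroups.
  The sum \<open>S + T\<close> is the elementwise one.\<close>

definition direct_decomp :: "'a::ring_1 set \<Rightarrow> 'a set \<Rightarrow> bool" where
  "direct_decomp S T \<longleftrightarrow> S + T = UNIV \<and> S \<inter> T = {0}"

text \<open>\<open>rho S T\<close> is meaningful only if \<open>direct_decomp S T\<close>, so every equation with \<open>rho S T\<close>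
  has to assert the decomposition as well: see \<open>is_rho\<close>.\<close>

definition rho :: "'a::ring_1 set \<Rightarrow> 'a set \<Rightarrow> 'a \<Rightarrow> 'a" where
  "rho S T r = (THE s. s \<in> S \<and> (\<exists>t\<in>T. r = s + t))"

lemma rho_add:
  fixes S T :: "'a::ring_1 set"
  assumes "direct_decomp S T"
    and S: "\<And>u v. u \<in> S \<Longrightarrow> v \<in> S \<Longrightarrow> u - v \<in> S"
    and T: "\<And>u v. u \<in> T \<Longrightarrow> v \<in> T \<Longrightarrow> u - v \<in> T"
    and "s \<in> S" "t \<in> T"
  shows "rho S T (s + t) = s"
  unfolding rho_def
proof (rule the_equality)
  show "s \<in> S \<and> (\<exists>t'\<in>T. s + t = s + t')"
    using assms by blast
next
  fix s' assume "s' \<in> S \<and> (\<exists>t'\<in>T. s + t = s' + t')"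
  then obtain t' where "s' \<in> S" "t' \<in> T" "s + t = s' + t'"
    by blast
  then have "s' - s = t - t'"
    by (simp add: algebra_simps)
  then have "s' - s \<in> S \<inter> T"
    using S[OF \<open>s' \<in> S\<close> \<open>s \<in> S\<close>] T[OF \<open>t \<in> T\<close> \<open>t' \<in> T\<close>] by simp
  then have "s' - s = 0"
    using assms(1) unfolding direct_decomp_def by blast
  then show "s' = s"
    by simp
qed

definition is_rho :: "('a::ring_1 \<Rightarrow> 'a) \<Rightarrow> 'a set \<Rightarrow> 'a set \<Rightarrow> bool" where
  "is_rho f S T \<longleftrightarrow> direct_decomp S T \<and> f = rho S T"

end

theory Submission
  imports Defs
begin

text \<open>
  A map \<open>f\<close> is the projection onto \<open>S\<close> along \<open>T\<close> exactly when it fixes \<open>S\<close>, kills \<open>T\<close>, and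
  splits every \<open>r\<close> as \<open>f r \<in> S\<close> plus \<open>r - f r \<in> T\<close> (lemma \<open>is_rho_iff\<close>); the direct
  decomposition itself follows from these conditions. For the four multiplication maps the
  conditions can be read off the equation \<open>a * x * a = a\<close>. Conversely that equation is a single
  instance of one of them: in the two cases where \<open>a\<close> generates the image, it says that \<open>f\<close>
  fixes \<open>a\<close>, and in the two cases where the kernel is an annihilator of \<open>a\<close>, it says that
  \<open>1 - f 1\<close> lies in that kernel.
\<close>

text \<open>The splitting \<open>r = f r + (r - f r)\<close> gives \<open>S + T = UNIV\<close>, and an element of \<open>S \<inter> T\<close>
  is both fixed and killed by \<open>f\<close>, hence zero. In the other direction,
  \<open>s = s + 0\<close> and \<open>t = 0 + t\<close> are the decompositions of \<open>s \<in> S\<close> and \<open>t \<in> T\<close>.\<close>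

lemma is_rho_iff:
  fixes S T :: "'a::ring_1 set"
  assumes S0: "0 \<in> S" and T0: "0 \<in> T"
    and S: "\<And>u v. u \<in> S \<Longrightarrow> v \<in> S \<Longrightarrow> u - v \<in> S"
    and T: "\<And>u v. u \<in> T \<Longrightarrow> v \<in> T \<Longrightarrow> u - v \<in> T"
  shows "is_rho f S T \<longleftrightarrow>
    (\<forall>s\<in>S. f s = s) \<and> (\<forall>t\<in>T. f t = 0) \<and> (\<forall>r. f r \<in> S \<and> r - f r \<in> T)"
    (is "_ \<longleftrightarrow> ?proj")
proof
  assume "is_rho f S T"
  then have D: "direct_decomp S T" and f: "f = rho S T"
    by (auto simp: is_rho_def)
  have f_add: "f (s + t) = s" if "s \<in> S" "t \<in> T" for s t
    unfolding f using rho_add[OF D S T] that by blast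
  have "f s = s" if "s \<in> S" for s
    using f_add[OF that T0] by simp
  moreover have "f t = 0" if "t \<in> T" for t
    using f_add[OF S0 that] by simp
  moreover have "f r \<in> S \<and> r - f r \<in> T" for r
  proof -
    have "r \<in> S + T"
      using D by (simp add: direct_decomp_def)
    then obtain s t where "r = s + t" "s \<in> S" "t \<in> T"
      by (rule set_plus_elim)
    then show ?thesis
      by (simp add: f_add)
  qed
  ultimately show ?proj
    by blast
next
  assume proj: ?proj
  have "r \<in> S + T" for r
    using set_plus_intro[of "f r" S "r - f r" T] proj by simp
  moreover have "S \<inter> T = {0}"
    using proj S0 T0 by force
  ultimately have D: "direct_decomp S T"
    by (auto simp: direct_decomp_def)
  have "rho S T r = f r" for r
    using rho_add[OF D S T, of "f r" "r - f r"] proj by simp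
  then show "is_rho f S T"
    using D by (auto simp: is_rho_def)
qed

lemma right_ideal_diff: "u \<in> right_ideal a \<Longrightarrow> v \<in> right_ideal a \<Longrightarrow> u - v \<in> right_ideal a"
  unfolding right_ideal_def by (auto simp flip: right_diff_distrib)

lemma left_ideal_diff: "u \<in> left_ideal a \<Longrightarrow> v \<in> left_ideal a \<Longrightarrow> u - v \<in> left_ideal a"
  unfolding left_ideal_def by (auto simp flip: left_diff_distrib)

lemma zero_in_right_ideal: "0 \<in> right_ideal a"
  unfolding right_ideal_def by (auto intro: exI[of _ 0])

lemma zero_in_left_ideal: "0 \<in> left_ideal a"
  unfolding left_ideal_def by (auto intro: exI[of _ 0])

lemma is_rho_right_ideal_rann_iff:
  "is_rho (lmult c) (right_ideal b) (rann d) \<longleftrightarrow>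
    (\<forall>r. c * (b * r) = b * r) \<and> (\<forall>t. d * t = 0 \<longrightarrow> c * t = 0) \<and>
    (\<forall>r. (\<exists>q. c * r = b * q) \<and> d * (r - c * r) = 0)"
proof -
  have "is_rho (lmult c) (right_ideal b) (rann d) \<longleftrightarrow>
    (\<forall>s\<in>right_ideal b. lmult c s = s) \<and> (\<forall>t\<in>rann d. lmult c t = 0) \<and>
    (\<forall>r. lmult c r \<in> right_ideal b \<and> r - lmult c r \<in> rann d)"
    by (rule is_rho_iff)
      (auto intro: zero_in_right_ideal right_ideal_diff simp: rann_def right_diff_distrib)
  then show ?thesis
    by (auto simp: right_ideal_def rann_def lmult_def)
qed

lemma is_rho_left_ideal_lann_iff:
  "is_rho (rmult c) (left_ideal b) (lann d) \<longleftrightarrow>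
    (\<forall>r. r * b * c = r * b) \<and> (\<forall>t. t * d = 0 \<longrightarrow> t * c = 0) \<and>
    (\<forall>r. (\<exists>q. r * c = q * b) \<and> (r - r * c) * d = 0)"
proof -
  have "is_rho (rmult c) (left_ideal b) (lann d) \<longleftrightarrow>
    (\<forall>s\<in>left_ideal b. rmult c s = s) \<and> (\<forall>t\<in>lann d. rmult c t = 0) \<and>
    (\<forall>r. rmult c r \<in> left_ideal b \<and> r - rmult c r \<in> lann d)"
    by (rule is_rho_iff)
      (auto intro: zero_in_left_ideal left_ideal_diff simp: lann_def left_diff_distrib)
  then show ?thesis
    by (auto simp: left_ideal_def lann_def rmult_def)
qed

theorem theorem3p1:
  fixes a x :: "'a::ring_1"
  shows "(x \<in> inner_inverses a \<longleftrightarrow> is_rho (lmult (a * x)) (right_ideal a) (rann (a * x)))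
    \<and> (x \<in> inner_inverses a \<longleftrightarrow> is_rho (lmult (x * a)) (right_ideal (x * a)) (rann a))
    \<and> (x \<in> inner_inverses a \<longleftrightarrow> is_rho (rmult (a * x)) (left_ideal (a * x)) (lann a))
    \<and> (x \<in> inner_inverses a \<longleftrightarrow> is_rho (rmult (x * a)) (left_ideal a) (lann (x * a)))"
proof -
  have inner: "x \<in> inner_inverses a \<longleftrightarrow> a * (x * a) = a"
    by (simp add: inner_inverses_def mult.assoc)
  \<comment> \<open>Under right-associated products, \<open>a * (x * a) = a\<close> only rewrites a trailing factor
    \<open>a\<close>; this instance covers the products that continue to the right.\<close>
  have absorb: "a * (x * (a * r)) = a * r" if "a * (x * a) = a" for r
    using arg_cong[OF that, of "\<lambda>y. y * r"] by (simp add: mult.assoc)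
  have two: "x \<in> inner_inverses a \<longleftrightarrow>
      is_rho (lmult (a * x)) (right_ideal a) (rann (a * x))"
  proof
    assume "x \<in> inner_inverses a"
    then show "is_rho (lmult (a * x)) (right_ideal a) (rann (a * x))"
      by (auto simp: inner is_rho_right_ideal_rann_iff mult.assoc right_diff_distrib absorb)
  next
    assume "is_rho (lmult (a * x)) (right_ideal a) (rann (a * x))"
    then have "a * x * (a * 1) = a * 1"
      unfolding is_rho_right_ideal_rann_iff by blast
    then show "x \<in> inner_inverses a"
      by (simp add: inner mult.assoc)
  qed
  have three: "x \<in> inner_inverses a \<longleftrightarrow>
      is_rho (lmult (x * a)) (right_ideal (x * a)) (rann a)"
  proof
    assume "x \<in> inner_inverses a"
    then show "is_rho (lmult (x * a)) (right_ideal (x * a)) (rann a)"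
      by (auto simp: inner is_rho_right_ideal_rann_iff mult.assoc right_diff_distrib absorb)
  next
    assume "is_rho (lmult (x * a)) (right_ideal (x * a)) (rann a)"
    then have "a * (1 - x * a * 1) = 0"
      unfolding is_rho_right_ideal_rann_iff by blast
    then show "x \<in> inner_inverses a"
      by (simp add: inner right_diff_distrib)
  qed
  have four: "x \<in> inner_inverses a \<longleftrightarrow>
      is_rho (rmult (a * x)) (left_ideal (a * x)) (lann a)"
  proof
    have kill: "t * (a * x) = 0" if "t * a = 0" for t
      using that by (simp flip: mult.assoc)
    assume "x \<in> inner_inverses a"
    then show "is_rho (rmult (a * x)) (left_ideal (a * x)) (lann a)"
      by (auto simp: inner is_rho_left_ideal_lann_iff mult.assoc left_diff_distrib absorb kill)
  next
    assume "is_rho (rmult (a * x)) (left_ideal (a * x)) (lann a)"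
    then have "(1 - 1 * (a * x)) * a = 0"
      unfolding is_rho_left_ideal_lann_iff by blast
    then show "x \<in> inner_inverses a"
      by (simp add: inner left_diff_distrib mult.assoc)
  qed
  have five: "x \<in> inner_inverses a \<longleftrightarrow>
      is_rho (rmult (x * a)) (left_ideal a) (lann (x * a))"
  proof
    have image: "\<exists>q. r * (x * a) = q * a" for r
      by (metis mult.assoc)
    assume "x \<in> inner_inverses a"
    then show "is_rho (rmult (x * a)) (left_ideal a) (lann (x * a))"
      by (auto simp: inner is_rho_left_ideal_lann_iff mult.assoc left_diff_distrib image)
  next
    assume "is_rho (rmult (x * a)) (left_ideal a) (lann (x * a))"
    then have "1 * a * (x * a) = 1 * a"
      unfolding is_rho_left_ideal_lann_iff by blast
    then show "x \<in> inner_inverses a"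
      by (simp add: inner)
  qed
  show ?thesis
    using two three four five by blast
qed

end
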